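(* If $q\in(1,M+1]\setminus\mathcal V$, then $\mathcal U_q=\overline{\mathcal U_q}=\mathcal V_q$.
   Context: Fix a positive integer $M$ and $A=\{0,1,\dots,M\}$. A sequence in $A^{\mathbb N}$ is finite if it has a last nonzero digit, infinite otherwise; doubly infinite if both it and $(M-c_i)$ are infinite. For $q\in(1,M+1]$ an expansion of $x$ in base $q$ is $(c_i)\in A^{\mathbb N}$ with $\sum_{i\ge1}c_iq^{-i}=x$; $J_q=[0,M/(q-1)]$ is the set of numbers having one. $\mathcal V$ is the set of $q>1$ such that $1$ has a unique doubly infinite expansion in base $q$. $\mathcal U_q$ is the set of $x\in J_q$ with a unique expansion in base $q$, $\overline{\mathcal U_q}$ its closure. For $q<M+1$, $\mathcal V_q$ is the set of $x\in J_q$ having a unique doubly infinite expansion; $\mathcal V_{M+1}=[0,1]$. *)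

theory Defs
  imports "HOL-Analysis.Analysis"
begin

text \<open>Sequences are indexed from 0, so the paper's digit \<open>c\<^sub>i\<close> (\<open>i \<ge> 1\<close>) is \<open>c (i - 1)\<close>.\<close>

definition digit_seqs :: "nat \<Rightarrow> (nat \<Rightarrow> nat) set" where
  "digit_seqs M = {c. \<forall>i. c i \<in> {0..M}}"

definition finite_seq :: "(nat \<Rightarrow> nat) \<Rightarrow> bool" where
  "finite_seq c \<longleftrightarrow> (\<exists>n. c n \<noteq> 0 \<and> (\<forall>m>n. c m = 0))"

text \<open>The zero sequence has no last nonzero digit, hence it is infinite.\<close>

definition infinite_seq :: "(nat \<Rightarrow> nat) \<Rightarrow> bool" where
  "infinite_seq c \<longleftrightarrow> \<not> finite_seq c"

definition doubly_infinite :: "nat \<Rightarrow> (nat \<Rightarrow> nat) \<Rightarrow> bool" where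
  "doubly_infinite M c \<longleftrightarrow> infinite_seq c \<and> infinite_seq (\<lambda>i. M - c i)"

definition is_expansion :: "nat \<Rightarrow> real \<Rightarrow> real \<Rightarrow> (nat \<Rightarrow> nat) \<Rightarrow> bool" where
  "is_expansion M q x c \<longleftrightarrow> c \<in> digit_seqs M \<and> (\<lambda>i. real (c i) / q ^ Suc i) sums x"

definition J_set :: "nat \<Rightarrow> real \<Rightarrow> real set" where
  "J_set M q = {0..real M / (q - 1)}"

text \<open>For \<open>q > M + 1\<close> the number 1 exceeds \<open>M / (q - 1)\<close> and has no expansion, so the
  set below is contained in \<open>(1, M + 1]\<close>.\<close>

definition V_bases :: "nat \<Rightarrow> real set" where
  "V_bases M = {q. q > 1 \<and> (\<exists>!c. is_expansion M q 1 c \<and> doubly_infinite M c)}"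

definition U_set :: "nat \<Rightarrow> real \<Rightarrow> real set" where
  "U_set M q = {x \<in> J_set M q. \<exists>!c. is_expansion M q x c}"

definition V_set :: "nat \<Rightarrow> real \<Rightarrow> real set" where
  "V_set M q =
     (if q = real M + 1 then {0..1}
      else {x \<in> J_set M q. \<exists>!c. is_expansion M q x c \<and> doubly_infinite M c})"

end

theory Submission imports Defs begin

text \<open>
  Let \<open>B = M / (q - 1)\<close>. The base \<open>q = M + 1\<close> belongs to \<open>V_bases M\<close>, so \<open>q < M + 1\<close>, i.e.
  \<open>B > 1\<close>. Quasi-greedy digit choices keep all remainders in \<open>(0, B)\<close>, so every number of
  \<open>(0, B)\<close>, in particular 1, has a doubly infinite expansion; as \<open>q\<close> is not in \<open>V_bases M\<close>, the
  number 1 has two of them. If \<open>x\<close> has a finite expansion, decrease its last nonzero digit by one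
  and append either expansion of 1: this yields two doubly infinite expansions of \<open>x\<close>, and by
  reflection the same holds when \<open>x\<close> has a co-finite one. Hence every \<open>x\<close> with two expansions has
  two doubly infinite ones, which gives \<open>V_set = U_set\<close>. At the first position where these two
  differ, both remainders lie in the open interval \<open>(0, B)\<close>, so all numbers near \<open>x\<close> can be
  expanded with either digit at that position; hence \<open>U_set\<close> is closed.
\<close>

section \<open>Digit sequences: concatenation, oscillation, reflection\<close>

definition prefix_cat :: "nat \<Rightarrow> (nat \<Rightarrow> nat) \<Rightarrow> (nat \<Rightarrow> nat) \<Rightarrow> nat \<Rightarrow> nat" where
  "prefix_cat n c e = (\<lambda>i. if i < n then c i else e (i - n))"

definition prefix_value :: "real \<Rightarrow> nat \<Rightarrow> (nat \<Rightarrow> nat) \<Rightarrow> real" where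
  "prefix_value q n c = (\<Sum>i<n. real (c i) / q ^ Suc i)"

text \<open>A stricter form of \<open>doubly_infinite\<close> that rules out the constant sequences
  0 and \<open>M\<close>. Unlike \<open>doubly_infinite\<close>, it survives putting arbitrary
  digits in front.\<close>

definition oscillating :: "nat \<Rightarrow> (nat \<Rightarrow> nat) \<Rightarrow> bool" where
  "oscillating M c \<longleftrightarrow> (\<forall>m. \<exists>n\<ge>m. c n \<noteq> 0) \<and> (\<forall>m. \<exists>n\<ge>m. c n \<noteq> M)"

text \<open>Downward induction from \<open>m\<close>: the first nonzero digit met on the way down
  would be the last nonzero digit of \<open>c\<close>.\<close>

lemma eventually_zero_cases:
  fixes c :: "nat \<Rightarrow> nat"
  assumes "\<forall>n\<ge>m. c n = 0"
  shows "c = (\<lambda>_. 0) \<or> finite_seq c"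
proof (rule disjCI)
  assume "\<not> finite_seq c"
  have "\<forall>n\<ge>k. c n = 0" if "k \<le> m" for k
    using that
  proof (induction rule: inc_induct)
    case base
    show ?case using assms .
  next
    case (step k)
    have "c k = 0"
      using \<open>\<not> finite_seq c\<close> step.IH unfolding finite_seq_def by (meson Suc_leI)
    with step.IH show ?case by (metis Suc_leI le_neq_implies_less)
  qed
  from this[of 0] show "c = (\<lambda>_. 0)" by auto
qed

lemma oscillating_imp_doubly_infinite:
  assumes "oscillating M c" "c \<in> digit_seqs M"
  shows "doubly_infinite M c"
proof -
  have "\<not> finite_seq c"
    using assms unfolding oscillating_def finite_seq_def by (meson Suc_le_lessD)
  moreover have "\<not> finite_seq (\<lambda>i. M - c i)"
  proof
    assume "finite_seq (\<lambda>i. M - c i)"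
    then obtain n where n: "\<forall>m>n. M - c m = 0" unfolding finite_seq_def by auto
    obtain m where "m \<ge> Suc n" "c m \<noteq> M" using assms(1) unfolding oscillating_def by blast
    moreover have "c m \<le> M" using assms(2) by (auto simp: digit_seqs_def)
    moreover have "M - c m = 0" using n \<open>m \<ge> Suc n\<close> by simp
    ultimately show False by simp
  qed
  ultimately show ?thesis by (simp add: doubly_infinite_def infinite_seq_def)
qed

text \<open>The two constants must be excluded because the zero sequence counts as infinite.\<close>

lemma doubly_infinite_imp_oscillating:
  assumes "doubly_infinite M c" "c \<in> digit_seqs M" "c \<noteq> (\<lambda>_. 0)" "c \<noteq> (\<lambda>_. M)"
  shows "oscillating M c"
proof -
  have le: "c i \<le> M" for i using assms(2) by (auto simp: digit_seqs_def)
  have "\<exists>n\<ge>m. c n \<noteq> 0" for m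
    using eventually_zero_cases[of m c] assms(1,3)
    unfolding doubly_infinite_def infinite_seq_def by blast
  moreover have "\<exists>n\<ge>m. c n \<noteq> M" for m
  proof (rule ccontr)
    assume "\<not> ?thesis"
    then have "(\<lambda>i. M - c i) = (\<lambda>_. 0)"
      using eventually_zero_cases[of m "\<lambda>i. M - c i"] assms(1)
      unfolding doubly_infinite_def infinite_seq_def by fastforce
    then have "c i = M" for i using le[of i] by (metis diff_is_0_eq le_antisym)
    with assms(4) show False by auto
  qed
  ultimately show ?thesis by (simp add: oscillating_def)
qed

lemma oscillating_prefix_cat:
  assumes "oscillating M e"
  shows "oscillating M (prefix_cat n c e)"
proof -
  have "\<exists>k\<ge>m. prefix_cat n c e k \<noteq> a" if inf: "\<forall>m. \<exists>k\<ge>m. e k \<noteq> a" for a m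
  proof -
    obtain k where "k \<ge> m" "e k \<noteq> a" using inf by blast
    then show ?thesis by (intro exI[of _ "k + n"]) (auto simp: prefix_cat_def)
  qed
  with assms show ?thesis unfolding oscillating_def by blast
qed

lemma reflect_digit_seqs: "(\<lambda>i. M - c i) \<in> digit_seqs M"
  by (auto simp: digit_seqs_def)

lemma reflect_reflect: "c \<in> digit_seqs M \<Longrightarrow> (\<lambda>i. M - (M - c i)) = c"
  by (auto simp: digit_seqs_def)

lemma doubly_infinite_reflect:
  assumes "c \<in> digit_seqs M" "doubly_infinite M c"
  shows "doubly_infinite M (\<lambda>i. M - c i)"
  using assms by (simp add: doubly_infinite_def reflect_reflect)

section \<open>Expansions in a base \<open>q > 1\<close>\<close>

lemma is_expansion_unique_value:
  "is_expansion M q x c \<Longrightarrow> is_expansion M q y c \<Longrightarrow> x = y"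
  unfolding is_expansion_def using sums_unique2 by blast

context
  fixes M :: nat and q :: real
  assumes q_gt_1: "1 < q"
begin

lemma const_sums: "(\<lambda>i. a / q ^ Suc i) sums (a / (q - 1))"
proof -
  have "(\<lambda>i. (a / q) * (1 / q) ^ i) sums ((a / q) * (1 / (1 - 1 / q)))"
    using q_gt_1 by (intro sums_mult geometric_sums) auto
  also have "(a / q) * (1 / (1 - 1 / q)) = a / (q - 1)"
    using q_gt_1 by (simp add: field_simps)
  finally show ?thesis by (simp add: field_simps)
qed

lemma is_expansion_const: "a \<le> M \<Longrightarrow> is_expansion M q (real a / (q - 1)) (\<lambda>_. a)"
  using const_sums[of "real a"] by (simp add: is_expansion_def digit_seqs_def)

text \<open>This symmetry turns facts about the endpoint 0 into facts about
  \<open>M / (q - 1)\<close>, and finite sequences into co-finite ones.\<close>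

lemma is_expansion_reflect:
  assumes "is_expansion M q x c"
  shows "is_expansion M q (real M / (q - 1) - x) (\<lambda>i. M - c i)"
proof -
  have le: "c i \<le> M" for i using assms by (auto simp: is_expansion_def digit_seqs_def)
  have "(\<lambda>i. real M / q ^ Suc i - real (c i) / q ^ Suc i) sums (real M / (q - 1) - x)"
    using assms by (intro sums_diff const_sums) (simp add: is_expansion_def)
  also have "(\<lambda>i. real M / q ^ Suc i - real (c i) / q ^ Suc i) = (\<lambda>i. real (M - c i) / q ^ Suc i)"
    using le by (simp add: of_nat_diff diff_divide_distrib)
  finally show ?thesis by (simp add: is_expansion_def reflect_digit_seqs)
qed

lemma is_expansion_nonneg:
  assumes "is_expansion M q x c"
  shows "0 \<le> x"
proof (rule sums_le)
  show "(\<lambda>_. 0::real) sums 0" by (rule sums_zero)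
  show "(\<lambda>i. real (c i) / q ^ Suc i) sums x" using assms by (simp add: is_expansion_def)
qed (use q_gt_1 in auto)

lemma is_expansion_le:
  assumes "is_expansion M q x c"
  shows "x \<le> real M / (q - 1)"
  using is_expansion_nonneg[OF is_expansion_reflect[OF assms]] by simp

lemma is_expansion_zeroD:
  assumes "is_expansion M q 0 c"
  shows "c i = 0"
proof -
  have s: "(\<lambda>i. real (c i) / q ^ Suc i) sums 0" using assms by (simp add: is_expansion_def)
  then have "\<forall>i. real (c i) / q ^ Suc i = 0"
    using suminf_eq_zero_iff[of "\<lambda>i. real (c i) / q ^ Suc i"] q_gt_1
    by (auto simp: sums_iff)
  then show ?thesis using q_gt_1 by auto
qed

lemma is_expansion_maxD:
  assumes "is_expansion M q (real M / (q - 1)) c"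
  shows "c i = M"
proof -
  have "M - c i = 0" using is_expansion_zeroD[OF is_expansion_reflect[OF assms, simplified]] by simp
  moreover have "c i \<le> M" using assms by (auto simp: is_expansion_def digit_seqs_def)
  ultimately show ?thesis by simp
qed

lemma is_expansion_tail:
  assumes "is_expansion M q x c"
  shows "is_expansion M q (q ^ n * (x - prefix_value q n c)) (\<lambda>i. c (i + n))"
proof -
  have "(\<lambda>i. real (c (i + n)) / q ^ Suc (i + n)) sums (x - prefix_value q n c)"
    using assms sums_split_initial_segment[of "\<lambda>i. real (c i) / q ^ Suc i" x n]
    by (simp add: is_expansion_def prefix_value_def)
  then have "(\<lambda>i. q ^ n * (real (c (i + n)) / q ^ Suc (i + n))) sums (q ^ n * (x - prefix_value q n c))"
    by (rule sums_mult)
  also have "(\<lambda>i. q ^ n * (real (c (i + n)) / q ^ Suc (i + n))) = (\<lambda>i. real (c (i + n)) / q ^ Suc i)"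
    using q_gt_1 by (auto simp: power_add)
  finally show ?thesis using assms by (auto simp: is_expansion_def digit_seqs_def)
qed

lemma is_expansion_prefix_cat:
  assumes "\<And>i. i < n \<Longrightarrow> c i \<le> M" "is_expansion M q y e"
  shows "is_expansion M q (prefix_value q n c + y / q ^ n) (prefix_cat n c e)"
proof -
  let ?f = "prefix_cat n c e"
  have "(\<lambda>i. real (e i) / q ^ Suc i / q ^ n) sums (y / q ^ n)"
    using assms(2) by (intro sums_divide) (simp add: is_expansion_def)
  also have "(\<lambda>i. real (e i) / q ^ Suc i / q ^ n) = (\<lambda>i. real (?f (i + n)) / q ^ Suc (i + n))"
    by (simp add: prefix_cat_def power_add mult.assoc)
  finally have "(\<lambda>i. real (?f i) / q ^ Suc i) sums (y / q ^ n + (\<Sum>i<n. real (?f i) / q ^ Suc i))"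
    by (subst (asm) sums_iff_shift)
  also have "(\<Sum>i<n. real (?f i) / q ^ Suc i) = prefix_value q n c"
    by (simp add: prefix_value_def prefix_cat_def)
  finally have "(\<lambda>i. real (?f i) / q ^ Suc i) sums (prefix_value q n c + y / q ^ n)"
    by (simp add: add.commute)
  moreover have "?f \<in> digit_seqs M"
    using assms by (auto simp: prefix_cat_def is_expansion_def digit_seqs_def)
  ultimately show ?thesis by (simp add: is_expansion_def)
qed

text \<open>A digit choice with bounded remainders determines an expansion, since the remainder after
  \<open>n\<close> digits contributes \<open>r n / q ^ n\<close>, which tends to 0.\<close>

lemma is_expansion_of_remainders:
  assumes "c \<in> digit_seqs M" "\<And>n. r (Suc n) = q * r n - real (c n)" "\<And>n. r n \<in> {0..b}"
  shows "is_expansion M q (r 0) c"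
proof -
  have eq: "prefix_value q n c = r 0 - r n / q ^ n" for n
  proof (induction n)
    case (Suc n)
    have "prefix_value q (Suc n) c = r 0 - r n / q ^ n + real (c n) / q ^ Suc n"
      using Suc by (simp add: prefix_value_def)
    also have "\<dots> = r 0 - r (Suc n) / q ^ Suc n"
      using q_gt_1 assms(2)[of n] by (simp add: field_simps)
    finally show ?case .
  qed (simp add: prefix_value_def)
  have "(\<lambda>n. b * (1 / q) ^ n) \<longlonglongrightarrow> b * 0"
    using q_gt_1 by (intro tendsto_mult tendsto_const LIMSEQ_power_zero) auto
  then have lim: "(\<lambda>n. b / q ^ n) \<longlonglongrightarrow> 0" by (simp add: power_one_over)
  have "(\<lambda>n. r n / q ^ n) \<longlonglongrightarrow> 0"
  proof (rule tendsto_sandwich[OF _ _ tendsto_const lim])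
    show "\<forall>\<^sub>F n in sequentially. 0 \<le> r n / q ^ n"
      using assms(3) q_gt_1 by (intro always_eventually allI) simp
    show "\<forall>\<^sub>F n in sequentially. r n / q ^ n \<le> b / q ^ n"
      using assms(3) q_gt_1 by (intro always_eventually allI divide_right_mono) auto
  qed
  then have "(\<lambda>n. r 0 - r n / q ^ n) \<longlonglongrightarrow> r 0 - 0" by (intro tendsto_diff tendsto_const)
  then have "(\<lambda>n. prefix_value q n c) \<longlonglongrightarrow> r 0" by (simp add: eq)
  then show ?thesis using assms(1) by (simp add: is_expansion_def sums_def prefix_value_def)
qed

section \<open>Existence of expansions for \<open>q < M + 1\<close>\<close>

context
  assumes q_less: "q < real M + 1"
begin

lemma max_value_gt_1: "1 < real M / (q - 1)"
  using q_gt_1 q_less by (simp add: field_simps)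

text \<open>The largest digit leaving a positive remainder works. If it is \<open>M\<close> because
  \<open>q * x > M\<close>, then \<open>x < M / (q - 1)\<close> makes the remainder smaller than
  \<open>x\<close>; otherwise the remainder is at most 1, which lies below
  \<open>M / (q - 1)\<close>.\<close>

lemma quasi_greedy_digit:
  assumes "0 < x" "x < real M / (q - 1)"
  obtains d where "d \<le> M" "0 < q * x - real d" "q * x - real d < real M / (q - 1)"
proof (cases "q * x > real M")
  case True
  have "x * (q - 1) < real M" using assms q_gt_1 by (simp add: pos_less_divide_eq)
  then have "q * x - real M < x" by (simp add: algebra_simps)
  with True show ?thesis using assms by (intro that[of M]) auto
next
  case False
  have pos: "0 < q * x" using assms q_gt_1 by simp
  define d where "d = nat (\<lceil>q * x\<rceil> - 1)"
  have "\<lceil>q * x\<rceil> \<ge> 1" using pos by linarith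
  then have d: "real d = of_int \<lceil>q * x\<rceil> - 1" by (simp add: d_def)
  have "0 < q * x - real d" "q * x - real d \<le> 1" using d by linarith+
  moreover have "d \<le> M" using False \<open>0 < q * x - real d\<close> by linarith
  ultimately show ?thesis using max_value_gt_1 by (intro that[of d]) auto
qed

text \<open>Iterate the quasi-greedy choice. A tail constantly 0 or \<open>M\<close> would force the
  remainder \<open>r m\<close> to an endpoint, but all remainders are interior.\<close>

lemma oscillating_expansion_exists:
  assumes "0 < x" "x < real M / (q - 1)"
  obtains c where "is_expansion M q x c" "oscillating M c"
proof -
  let ?B = "real M / (q - 1)"
  have "\<forall>y. \<exists>d. 0 < y \<and> y < ?B \<longrightarrow> d \<le> M \<and> 0 < q * y - real d \<and> q * y - real d < ?B"
    using quasi_greedy_digit by blast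
  then obtain d where d: "\<And>y. 0 < y \<Longrightarrow> y < ?B \<Longrightarrow>
      d y \<le> M \<and> 0 < q * y - real (d y) \<and> q * y - real (d y) < ?B"
    by metis
  define r where "r = rec_nat x (\<lambda>_ y. q * y - real (d y))"
  define c where "c = (\<lambda>n. d (r n))"
  have r0: "r 0 = x" and rS: "r (Suc n) = q * r n - real (c n)" for n
    by (simp_all add: r_def c_def)
  have r: "0 < r n \<and> r n < ?B" for n
  proof (induction n)
    case 0
    then show ?case using assms r0 by simp
  next
    case (Suc n)
    then show ?case using d[of "r n"] by (simp add: rS c_def)
  qed
  have digits: "(\<lambda>n. c (n + m)) \<in> digit_seqs M" for m
    using r d by (auto simp: digit_seqs_def c_def)
  have tail: "is_expansion M q (r m) (\<lambda>n. c (n + m))" for m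
    using is_expansion_of_remainders[of "\<lambda>n. c (n + m)" "\<lambda>n. r (n + m)" ?B] digits rS r
    by (simp add: less_imp_le)
  have tail_const: False if "a \<le> M" "\<forall>n\<ge>m. c n = a" "a = 0 \<or> a = M" for a m
  proof -
    have "(\<lambda>n. c (n + m)) = (\<lambda>_. a)" using that(2) by auto
    then have "r m = real a / (q - 1)"
      using tail[of m] is_expansion_const[OF that(1)] by (metis is_expansion_unique_value)
    then show False using r[of m] that(3) by auto
  qed
  have "oscillating M c" unfolding oscillating_def using tail_const[of 0] tail_const[of M] by blast
  then show thesis using that tail[of 0] r0 by simp
qed

lemma expansion_exists:
  assumes "x \<in> J_set M q"
  obtains c where "is_expansion M q x c"
proof -
  consider "x = 0" | "x = real M / (q - 1)" | "0 < x" "x < real M / (q - 1)"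
    using assms by (fastforce simp: J_set_def)
  then show thesis
    using that is_expansion_const[of 0] is_expansion_const[of M] oscillating_expansion_exists
    by cases (simp, blast+)
qed

text \<open>Both remainders behind the first position where the two expansions differ are interior
  points of \<open>J_set M q\<close>, so a small change of \<open>x\<close> can be absorbed by either of them.\<close>

lemma two_doubly_infinite_nearby:
  assumes c: "is_expansion M q x c" "doubly_infinite M c"
    and d: "is_expansion M q x d" "doubly_infinite M d" and "c \<noteq> d"
  shows "\<exists>\<epsilon>>0. \<forall>y. \<bar>y - x\<bar> < \<epsilon> \<longrightarrow>
    (\<exists>e f. is_expansion M q y e \<and> is_expansion M q y f \<and> e \<noteq> f)"
proof -
  let ?B = "real M / (q - 1)"
  define n where "n = (LEAST n. c n \<noteq> d n)"
  have "\<exists>n. c n \<noteq> d n" using \<open>c \<noteq> d\<close> by auto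
  then have neq: "c n \<noteq> d n" unfolding n_def by (rule LeastI_ex)
  have same: "c i = d i" if "i < n" for i using that not_less_Least unfolding n_def by blast
  \<comment> \<open>Stated for fresh \<open>c\<close> and \<open>d\<close>, so that the roles can be
    swapped to get \<open>c n < d n\<close>.\<close>
  have main: "\<exists>\<epsilon>>0. \<forall>y. \<bar>y - x\<bar> < \<epsilon> \<longrightarrow>
      (\<exists>e f. is_expansion M q y e \<and> is_expansion M q y f \<and> e \<noteq> f)"
    if c: "is_expansion M q x c" "doubly_infinite M c"
      and d: "is_expansion M q x d" "doubly_infinite M d"
      and lt: "c n < d n" and same: "\<And>i. i < n \<Longrightarrow> c i = d i" for c d
  proof -
    define s where "s = (\<lambda>c. q ^ Suc n * (x - prefix_value q (Suc n) c))"
    have ts: "is_expansion M q (s c) (\<lambda>i. c (i + Suc n))" "is_expansion M q (s d) (\<lambda>i. d (i + Suc n))"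
      using is_expansion_tail[of _ _ "Suc n"] c d unfolding s_def by blast+
    have le: "c i \<le> M" "d i \<le> M" for i
      using c d by (auto simp: is_expansion_def digit_seqs_def)
    have pv: "prefix_value q n c = prefix_value q n d"
      unfolding prefix_value_def using same by simp
    \<comment> \<open>The smaller digit leaves the larger remainder, so both remainders are interior
      once \<open>s d > 0\<close> and \<open>s c\<close> is below the upper endpoint.\<close>
    have s_eq: "s c = s d + (real (d n) - real (c n))"
    proof -
      have "prefix_value q (Suc n) d = prefix_value q (Suc n) c + (real (d n) - real (c n)) / q ^ Suc n"
        using pv by (simp add: prefix_value_def diff_divide_distrib)
      then show ?thesis using q_gt_1 unfolding s_def by (simp add: field_simps)
    qed
    \<comment> \<open>A zero remainder would make \<open>d n\<close>, which exceeds
      \<open>c n\<close>, the last nonzero digit of \<open>d\<close>.\<close>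
    have "s d \<noteq> 0"
    proof
      assume "s d = 0"
      then have z: "d (i + Suc n) = 0" for i
        using is_expansion_zeroD ts(2) by metis
      have "d m = 0" if "m > n" for m using z[of "m - Suc n"] that by simp
      then have "finite_seq d" using lt unfolding finite_seq_def by (metis not_less0)
      with d(2) show False by (simp add: doubly_infinite_def infinite_seq_def)
    qed
    then have sd: "s d > 0" using is_expansion_nonneg[OF ts(2)] by simp
    have "s c \<noteq> ?B"
    proof
      assume "s c = ?B"
      then have z: "c (i + Suc n) = M" for i
        using is_expansion_maxD ts(1) by metis
      have "M - c m = 0" if "m > n" for m using z[of "m - Suc n"] that by simp
      moreover have "M - c n \<noteq> 0" using lt le(2)[of n] by simp
      ultimately have "finite_seq (\<lambda>i. M - c i)" unfolding finite_seq_def by blast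
      with c(2) show False by (simp add: doubly_infinite_def infinite_seq_def)
    qed
    then have sc: "s c < ?B" using is_expansion_le[OF ts(1)] by simp
    define \<epsilon> where "\<epsilon> = min (s d) (?B - s c) / q ^ Suc n"
    have "\<epsilon> > 0" using sd sc q_gt_1 by (simp add: \<epsilon>_def)
    moreover have "\<exists>e f. is_expansion M q y e \<and> is_expansion M q y f \<and> e \<noteq> f"
      if y: "\<bar>y - x\<bar> < \<epsilon>" for y
    proof -
      \<comment> \<open>Moving \<open>x\<close> to \<open>y\<close> shifts both remainders by the
        same \<open>t\<close>; \<epsilon> is chosen so that neither leaves the open
        interval.\<close>
      define t where "t = q ^ Suc n * (y - x)"
      have qpos: "q ^ Suc n > 0" using q_gt_1 by simp
      have "\<bar>t\<bar> = \<bar>y - x\<bar> * q ^ Suc n" using q_gt_1 by (simp add: t_def abs_mult)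
      also have "\<dots> < min (s d) (?B - s c)"
        using y qpos unfolding \<epsilon>_def by (simp only: pos_less_divide_eq)
      finally have t: "\<bar>t\<bar> < s d" "\<bar>t\<bar> < ?B - s c" by auto
      have ext: "\<exists>e. is_expansion M q y (prefix_cat (Suc n) a e)"
        if a: "\<And>i. a i \<le> M" "0 < s a + t" "s a + t < ?B" for a
      proof -
        obtain e where "is_expansion M q (s a + t) e"
          using oscillating_expansion_exists[OF a(2,3)] by blast
        then have "is_expansion M q (prefix_value q (Suc n) a + (s a + t) / q ^ Suc n)
            (prefix_cat (Suc n) a e)"
          using a(1) is_expansion_prefix_cat by blast
        moreover have "prefix_value q (Suc n) a + (s a + t) / q ^ Suc n = y"
        proof -
          have "s a + t = q ^ Suc n * (y - prefix_value q (Suc n) a)"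
            by (simp add: s_def t_def algebra_simps)
          then show ?thesis using q_gt_1 by simp
        qed
        ultimately show ?thesis by auto
      qed
      have "0 < s d + t" "s d + t < ?B" "0 < s c + t" "s c + t < ?B"
        using t sd sc s_eq lt by linarith+
      then obtain e f where ef: "is_expansion M q y (prefix_cat (Suc n) c e)"
          "is_expansion M q y (prefix_cat (Suc n) d f)"
        using ext[of c] ext[of d] le by blast
      moreover have "prefix_cat (Suc n) c e n \<noteq> prefix_cat (Suc n) d f n"
        using lt by (simp add: prefix_cat_def)
      ultimately show ?thesis by metis
    qed
    ultimately show ?thesis by blast
  qed
  from neq consider "c n < d n" | "d n < c n" by linarith
  then show ?thesis
    using main[OF c d] main[OF d c] same by cases simp_all
qed

section \<open>Bases outside \<open>V_bases M\<close>\<close>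

context
  assumes not_V: "q \<notin> V_bases M"
begin

text \<open>Since 1 lies strictly between 0 and \<open>M / (q - 1)\<close>, no expansion of it is
  constantly 0 or \<open>M\<close>; its doubly infinite expansions therefore all oscillate.\<close>

lemma one_has_two_oscillating:
  obtains e f where "is_expansion M q 1 e" "oscillating M e"
    "is_expansion M q 1 f" "oscillating M f" "e \<noteq> f"
proof -
  have osc: "oscillating M e" if "is_expansion M q 1 e" "doubly_infinite M e" for e
  proof (rule doubly_infinite_imp_oscillating[OF that(2)])
    show "e \<in> digit_seqs M" using that by (simp add: is_expansion_def)
    show "e \<noteq> (\<lambda>_. 0)"
      using is_expansion_unique_value[OF that(1)] is_expansion_const[of 0] by fastforce
    show "e \<noteq> (\<lambda>_. M)"
      using is_expansion_unique_value[OF that(1)] is_expansion_const[of M] max_value_gt_1 by fastforce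
  qed
  obtain e where e: "is_expansion M q 1 e" "oscillating M e"
    using oscillating_expansion_exists[of 1] max_value_gt_1 by auto
  then have "doubly_infinite M e"
    using oscillating_imp_doubly_infinite by (simp add: is_expansion_def)
  then obtain f where "is_expansion M q 1 f" "doubly_infinite M f" "e \<noteq> f"
    using not_V q_gt_1 e unfolding V_bases_def by blast
  then show thesis using that e osc by blast
qed

lemma finite_expansion_two_doubly_infinite:
  assumes "is_expansion M q x c" "finite_seq c"
  shows "\<exists>e f. is_expansion M q x e \<and> doubly_infinite M e \<and>
    is_expansion M q x f \<and> doubly_infinite M f \<and> e \<noteq> f"
proof -
  obtain n where n: "c n \<noteq> 0" "\<And>m. m > n \<Longrightarrow> c m = 0"
    using assms(2) unfolding finite_seq_def by blast
  define b where "b = c(n := c n - 1)"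
  have b: "b i \<le> M" for i
    using assms(1) by (auto simp: b_def is_expansion_def digit_seqs_def le_diff_conv le_Suc_eq)
  have "prefix_cat (Suc n) c (\<lambda>_. 0) = c" using n(2) by (auto simp: prefix_cat_def)
  then have "is_expansion M q (prefix_value q (Suc n) c + 0 / q ^ Suc n) c"
    using is_expansion_prefix_cat[of "Suc n" c 0 "\<lambda>_. 0"] is_expansion_const[of 0] assms(1)
    by (simp add: is_expansion_def digit_seqs_def)
  then have "x = prefix_value q (Suc n) c"
    using is_expansion_unique_value[OF assms(1)] by simp
  \<comment> \<open>The unit borrowed from digit \<open>n\<close> is worth
    \<open>1 / q ^ Suc n\<close>, exactly what an expansion of 1 contributes when appended after
    that digit.\<close>
  also have "\<dots> = prefix_value q (Suc n) b + 1 / q ^ Suc n"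
    using n(1) by (simp add: prefix_value_def b_def of_nat_diff diff_divide_distrib)
  finally have x: "x = prefix_value q (Suc n) b + 1 / q ^ Suc n" .
  have step: "is_expansion M q x (prefix_cat (Suc n) b e) \<and> doubly_infinite M (prefix_cat (Suc n) b e)"
    if "is_expansion M q 1 e" "oscillating M e" for e
  proof -
    have exp: "is_expansion M q x (prefix_cat (Suc n) b e)"
      using is_expansion_prefix_cat[of "Suc n" b 1 e] that b x by simp
    then show ?thesis
      using oscillating_imp_doubly_infinite oscillating_prefix_cat that
      by (simp add: is_expansion_def)
  qed
  obtain e f where ef: "is_expansion M q 1 e" "oscillating M e"
    "is_expansion M q 1 f" "oscillating M f" "e \<noteq> f"
    using one_has_two_oscillating by blast
  then obtain i where "e i \<noteq> f i" by blast
  then have "prefix_cat (Suc n) b e (i + Suc n) \<noteq> prefix_cat (Suc n) b f (i + Suc n)"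
    by (simp add: prefix_cat_def)
  then have "prefix_cat (Suc n) b e \<noteq> prefix_cat (Suc n) b f" by metis
  then show ?thesis using step ef by blast
qed

lemma not_doubly_infinite_two_doubly_infinite:
  assumes "is_expansion M q x c" "\<not> doubly_infinite M c"
  shows "\<exists>e f. is_expansion M q x e \<and> doubly_infinite M e \<and>
    is_expansion M q x f \<and> doubly_infinite M f \<and> e \<noteq> f"
proof (cases "finite_seq c")
  case True
  then show ?thesis using finite_expansion_two_doubly_infinite assms by blast
next
  case False
  then have "finite_seq (\<lambda>i. M - c i)"
    using assms(2) by (simp add: doubly_infinite_def infinite_seq_def)
  then obtain e f where e: "is_expansion M q (real M / (q - 1) - x) e" "doubly_infinite M e"
    and f: "is_expansion M q (real M / (q - 1) - x) f" "doubly_infinite M f" and "e \<noteq> f"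
    using finite_expansion_two_doubly_infinite[OF is_expansion_reflect[OF assms(1)]] by blast
  have digits: "e \<in> digit_seqs M" "f \<in> digit_seqs M" using e f by (auto simp: is_expansion_def)
  \<comment> \<open>Truncated subtraction from \<open>M\<close> is injective only on digits at most
    \<open>M\<close>, hence the detour through double reflection.\<close>
  have "(\<lambda>i. M - e i) \<noteq> (\<lambda>i. M - f i)"
  proof
    assume "(\<lambda>i. M - e i) = (\<lambda>i. M - f i)"
    then have "(\<lambda>i. M - (M - e i)) = (\<lambda>i. M - (M - f i))" by metis
    then show False using digits \<open>e \<noteq> f\<close> by (simp add: reflect_reflect)
  qed
  moreover have "is_expansion M q x (\<lambda>i. M - e i)" "is_expansion M q x (\<lambda>i. M - f i)"
    using is_expansion_reflect[OF e(1)] is_expansion_reflect[OF f(1)] by simp_all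
  ultimately show ?thesis using doubly_infinite_reflect digits e f by blast
qed

text \<open>Take two expansions: either both are doubly infinite already, or one that is not yields
  the required pair.\<close>

lemma not_U_two_doubly_infinite:
  assumes "x \<in> J_set M q" "x \<notin> U_set M q"
  shows "\<exists>e f. is_expansion M q x e \<and> doubly_infinite M e \<and>
    is_expansion M q x f \<and> doubly_infinite M f \<and> e \<noteq> f"
proof -
  obtain c where c: "is_expansion M q x c" using expansion_exists assms(1) by blast
  then obtain d where "is_expansion M q x d" "c \<noteq> d" using assms unfolding U_set_def by blast
  then show ?thesis using c not_doubly_infinite_two_doubly_infinite by metis
qed

lemma U_set_eq_V_set: "U_set M q = V_set M q"
proof -
  have V: "V_set M q = {x \<in> J_set M q. \<exists>!c. is_expansion M q x c \<and> doubly_infinite M c}"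
    using q_less by (simp add: V_set_def)
  have "U_set M q \<subseteq> V_set M q"
  proof
    fix x assume "x \<in> U_set M q"
    then obtain c where c: "x \<in> J_set M q" "is_expansion M q x c"
      "\<And>d. is_expansion M q x d \<Longrightarrow> d = c" unfolding U_set_def by auto
    then have "doubly_infinite M c" using not_doubly_infinite_two_doubly_infinite by metis
    then show "x \<in> V_set M q" using c unfolding V by blast
  qed
  moreover have "V_set M q \<subseteq> U_set M q"
    using not_U_two_doubly_infinite unfolding V by blast
  ultimately show ?thesis by blast
qed

lemma closed_U_set: "closed (U_set M q)"
  unfolding closed_def open_dist
proof (intro ballI)
  fix x assume x: "x \<in> - U_set M q"
  show "\<exists>\<epsilon>>0. \<forall>y. dist y x < \<epsilon> \<longrightarrow> y \<in> - U_set M q"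
  proof (cases "x \<in> J_set M q")
    case True
    then obtain e f where "is_expansion M q x e" "doubly_infinite M e"
      "is_expansion M q x f" "doubly_infinite M f" "e \<noteq> f"
      using not_U_two_doubly_infinite[OF True] x by auto
    then obtain \<epsilon> where "\<epsilon> > 0" and two: "\<forall>y. \<bar>y - x\<bar> < \<epsilon> \<longrightarrow>
        (\<exists>e f. is_expansion M q y e \<and> is_expansion M q y f \<and> e \<noteq> f)"
      using two_doubly_infinite_nearby[of x e f] by auto
    \<comment> \<open>Two expansions exclude \<open>y\<close> from \<open>U_set M q\<close> whether
      or not \<open>y\<close> lies in \<open>J_set M q\<close>.\<close>
    have "y \<in> - U_set M q" if "dist y x < \<epsilon>" for y
      using two that unfolding U_set_def dist_real_def by blast
    then show ?thesis using \<open>\<epsilon> > 0\<close> by blast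
  next
    case False
    have "open (- J_set M q)" by (simp add: J_set_def open_Compl)
    then show ?thesis using False unfolding open_dist U_set_def by blast
  qed
qed

end

end

end

section \<open>The base \<open>M + 1\<close> and the conclusion\<close>

text \<open>Here 1 is the right endpoint \<open>M / (q - 1)\<close>, whose only expansion is
  constantly \<open>M\<close>. That sequence is doubly infinite because its reflection, the zero
  sequence, counts as infinite.\<close>

lemma Suc_M_in_V_bases:
  assumes "M > 0"
  shows "real M + 1 \<in> V_bases M"
proof -
  have q: "1 < real M + 1" using assms by simp
  have B: "real M / (real M + 1 - 1) = 1" using assms by simp
  have "doubly_infinite M (\<lambda>_. M)"
    using assms by (auto simp: doubly_infinite_def infinite_seq_def finite_seq_def)
  moreover have "is_expansion M (real M + 1) 1 (\<lambda>_. M)"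
    using is_expansion_const[OF q, of M M] by (simp only: B order_refl)
  moreover have "c = (\<lambda>_. M)" if "is_expansion M (real M + 1) 1 c" for c
    using is_expansion_maxD[OF q, of M c] that unfolding B by auto
  ultimately show ?thesis using q unfolding V_bases_def by blast
qed

theorem theorem1p4:
  fixes M :: nat and q :: real
  assumes "M > 0"
    and "q \<in> {1<..real M + 1} - V_bases M"
  shows "U_set M q = closure (U_set M q) \<and> closure (U_set M q) = V_set M q"
proof -
  have "q \<noteq> real M + 1" using assms Suc_M_in_V_bases by auto
  then have "1 < q" "q < real M + 1" "q \<notin> V_bases M" using assms by auto
  then show ?thesis using U_set_eq_V_set closed_U_set by (simp add: closure_closed)
qed

end
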